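(* There is a Yao graph $Y_5$ on a finite set $S$ of points in the Euclidean plane whose stretch factor is more than $2.87$; that is, there are distinct points $a,b\in S$ with $d_{Y_5}(a,b) > 2.87\,\|ab\|$. Consequently $2.87$ is a lower bound on the stretch factor of $Y_5$ graphs.
   Context: $\|ab\|$ denotes Euclidean distance. Let $S$ be a set of points in the plane. Fix an ordering $\prec$ on all pairs $\{a,b\}$ of points of $S$ based on Euclidean distance, with ties broken arbitrarily: if $\|ab\|<\|cd\|$ then $\{a,b\}\prec\{c,d\}$. Cones: for each point $p\in S$, the plane is partitioned into five cones $C_1^p,\dots,C_5^p$ with apex $p$, each of angle $2\pi/5$, labelled in counterclockwise order. The orientation of the cones is the same for all points. The two boundary rays of a cone are its start-ray and end-ray, in counterclockwise order, and the start-ray of $C_1^p$ is horizontal and points to the right. (It is not specified to which of the two adjacent cones a common boundary ray belongs.) Directed Yao graph $\overrightarrow{Y_5}$: for each $p\in S$, in each of its five cones $p$ chooses the closest point $q$ of $S$ (if any) according to the ordering $\prec$, and the directed edge $(p,q)$ is added to $\overrightarrow{Y_5}$. The Yao graph $Y_5$ is the underlying undirected graph of $\overrightarrow{Y_5}$. For a graph $G$ on $S$ whose edges $ab$ have length $\|ab\|$, $d_G(a,b)$ is the length of a shortest path in $G$ between $a$ and $b$. The stretch factor of $G$ is the smallest $\rho$ such that $d_G(a,b)\le\rho\,\|ab\|$ for every two points $a,b\in S$. *)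

theory Defs
  imports "HOL-Analysis.Analysis" "Graph_Theory.Shortest_Path" "Graph_Theory.Digraph_Component"
begin

text \<open>
  The plane is the type \<^typ>\<open>complex\<close>, whose \<^const>\<open>dist\<close> is the Euclidean distance.

  The cones are numbered from 0 to 4 instead of from 1 to 5.  The cones with a common apex have to
  partition the plane, but it is left open to which of its two adjacent cones a boundary ray
  belongs. This choice is the parameter \<open>own\<close>: the start-ray of cone \<open>i\<close> belongs to cone \<open>i\<close>
  if \<open>own i\<close> holds, and to the preceding cone otherwise. As the cones at different apices
  are translates of each other, the choice does not depend on the apex.
\<close>

definition cone :: "(nat \<Rightarrow> bool) \<Rightarrow> complex \<Rightarrow> nat \<Rightarrow> complex set" where
  "cone own p i =
    {p + of_real r * cis t | r t. r > 0 \<and>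
       2 * pi * real i / 5 \<le> t \<and> t \<le> 2 * pi * real (i + 1) / 5 \<and>
       (t = 2 * pi * real i / 5 \<longrightarrow> own i) \<and>
       (t = 2 * pi * real (i + 1) / 5 \<longrightarrow> \<not> own ((i + 1) mod 5))}"

definition point_pairs :: "complex set \<Rightarrow> complex set set" where
  "point_pairs S = {{a, b} | a b. a \<in> S \<and> b \<in> S \<and> a \<noteq> b}"

definition distance_order :: "complex set \<Rightarrow> complex set rel \<Rightarrow> bool" where
  "distance_order S R \<longleftrightarrow>
     strict_linear_order_on (point_pairs S) R \<and>
     (\<forall>a\<in>S. \<forall>b\<in>S. \<forall>c\<in>S. \<forall>d\<in>S. a \<noteq> b \<longrightarrow> c \<noteq> d \<longrightarrow>
        dist a b < dist c d \<longrightarrow> ({a, b}, {c, d}) \<in> R)"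

definition directed_Y5 ::
    "(nat \<Rightarrow> bool) \<Rightarrow> complex set \<Rightarrow> complex set rel \<Rightarrow> complex pair_pre_digraph" where
  "directed_Y5 own S R =
    \<lparr>pverts = S,
     parcs = {(p, q). p \<in> S \<and> (\<exists>i<5. q \<in> S \<inter> cone own p i \<and>
       (\<forall>q' \<in> S \<inter> cone own p i. q' \<noteq> q \<longrightarrow> ({p, q}, {p, q'}) \<in> R))}\<rparr>"

text \<open>An undirected graph is represented by the digraph that has both orientations of each edge.\<close>

definition Y5 ::
    "(nat \<Rightarrow> bool) \<Rightarrow> complex set \<Rightarrow> complex set rel \<Rightarrow> complex pair_pre_digraph" where
  "Y5 own S R = mk_symmetric (with_proj (directed_Y5 own S R))"

text \<open>
  \<open>wf_digraph.\<mu>\<close> is the infimum of the weights of all walks, which for nonnegative weights is the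
  length of a shortest path. It is infinite if there is no path.
\<close>

definition graph_dist :: "complex pair_pre_digraph \<Rightarrow> complex \<Rightarrow> complex \<Rightarrow> ereal" where
  "graph_dist G = wf_digraph.\<mu> (with_proj G) (\<lambda>(u, v). dist u v)"

definition stretch_factor :: "complex pair_pre_digraph \<Rightarrow> ereal" where
  "stretch_factor G =
    Inf {\<rho>. \<forall>a \<in> pverts G. \<forall>b \<in> pverts G. graph_dist G a b \<le> \<rho> * ereal (dist a b)}"

end

(*
  A function on the points that changes along each edge by at most the length of the edge is a lower
  bound, up to its value at a, on the graph distance from a. For a suitable set of 18 points with
  integer coordinates, such an integer potential grows from a to b by more than 2.88 times the
  distance of a and b. That the potential is admissible is a finite integer computation: whenever it
  changes between p and q by more than their distance, neither chooses the other, because another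
  point lies strictly closer in the interior of the same cone. As only interiors of cones and strict
  inequalities occur, neither the ownership of the boundary rays nor the tie-breaking matters.
*)

theory Submission
  imports Defs
begin

section \<open>Trigonometry of the angles pi/5 and 2 pi/5\<close>

text \<open>As 3 pi/5 and 2 pi/5 add up to pi, their cosines are opposite. The triple and double
  angle formulas turn this into a cubic in \<open>cos (pi / 5)\<close>, and splitting off its root
  -1 leaves this quadratic.\<close>

lemma cos_pi_fifth: "4 * (cos (pi / 5))\<^sup>2 - 2 * cos (pi / 5) - 1 = 0"
proof -
  let ?c = "cos (pi / 5)"
  have "cos (3 * (pi / 5)) = - cos (2 * (pi / 5))"
    using cos_pi_minus[of "2 * (pi / 5)"] by (simp add: field_simps)
  then have "4 * ?c ^ 3 - 3 * ?c = - (2 * ?c\<^sup>2 - 1)"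
    by (simp only: cos_treble_cos cos_double_cos)
  then have "(?c + 1) * (4 * ?c\<^sup>2 - 2 * ?c - 1) = 0"
    by (simp add: algebra_simps power2_eq_square power3_eq_cube)
  moreover have "?c > 0"
    by (rule cos_gt_zero) auto
  ultimately show ?thesis
    by simp
qed

lemma cos_pi_fifth_bounds:
  "0.8090169 < cos (pi / 5)" "cos (pi / 5) < 0.809017"
proof -
  let ?c = "cos (pi / 5)"
  have pos: "?c > 0"
    by (rule cos_gt_zero) auto
  \<comment> \<open>Written as a product of two positive increasing factors, the quadratic turns any
    violated bound into a product on the wrong side of 1.\<close>
  have eq: "?c * (4 * ?c - 2) = 1"
    using cos_pi_fifth by (simp add: algebra_simps power2_eq_square)
  then have ge: "4 * ?c - 2 > 0"
    using pos by (metis zero_less_mult_pos zero_less_one)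
  show "0.8090169 < ?c"
  proof (rule ccontr)
    assume "\<not> ?thesis"
    then have "?c * (4 * ?c - 2) \<le> 0.8090169 * (4 * 0.8090169 - 2)"
      using pos ge by (intro mult_mono) auto
    with eq show False by simp
  qed
  show "?c < 0.809017"
  proof (rule ccontr)
    assume "\<not> ?thesis"
    then have "0.809017 * (4 * 0.809017 - 2) \<le> ?c * (4 * ?c - 2)"
      using pos ge by (intro mult_mono) auto
    with eq show False by simp
  qed
qed

text \<open>These enclose tan (pi/5). After squaring, the quadratic for the cosine makes both sides
  linear in it, so the decimal bounds on the cosine suffice.\<close>

lemma sin_pi_fifth_bounds:
  "0.7265 * cos (pi / 5) < sin (pi / 5)" "sin (pi / 5) < 0.7266 * cos (pi / 5)"
proof -
  let ?c = "cos (pi / 5)" and ?s = "sin (pi / 5)"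
  have s: "?s > 0"
    by (rule sin_gt_zero) auto
  have sq: "?s\<^sup>2 = 1 - ?c\<^sup>2"
    by (rule sin_squared_eq)
  have c2: "4 * ?c\<^sup>2 = 2 * ?c + 1"
    using cos_pi_fifth by simp
  show "0.7265 * ?c < ?s"
  proof (rule power2_less_imp_less)
    show "(0.7265 * ?c)\<^sup>2 < ?s\<^sup>2"
      unfolding sq power_mult_distrib using c2 cos_pi_fifth_bounds
      by (simp add: power2_eq_square)
  qed (use s in simp)
  show "?s < 0.7266 * ?c"
  proof (rule power2_less_imp_less)
    show "?s\<^sup>2 < (0.7266 * ?c)\<^sup>2"
      unfolding sq power_mult_distrib using c2 cos_pi_fifth_bounds
      by (simp add: power2_eq_square)
  qed (use cos_pi_fifth_bounds in simp)
qed

lemma sin_two_pi_fifths_bounds: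
  "3.0776 * cos (2 * pi / 5) < sin (2 * pi / 5)" "sin (2 * pi / 5) < 3.0777 * cos (2 * pi / 5)"
  "0 < cos (2 * pi / 5)"
proof -
  let ?c = "cos (2 * pi / 5)" and ?s = "sin (2 * pi / 5)"
  have s: "?s > 0"
    by (rule sin_gt_zero) auto
  have "?c = 2 * (cos (pi / 5))\<^sup>2 - 1"
    using cos_double_cos[of "pi / 5"] by simp
  then have c: "?c = cos (pi / 5) - 1 / 2"
    using cos_pi_fifth by simp
  have sq: "?s\<^sup>2 = 1 - ?c\<^sup>2"
    by (rule sin_squared_eq)
  have c2: "4 * ?c\<^sup>2 = 1 - 2 * ?c"
    using cos_pi_fifth unfolding c by (simp add: power2_eq_square algebra_simps)
  have b: "0.3090169 < ?c" "?c < 0.309017"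
    using cos_pi_fifth_bounds unfolding c by auto
  show "0 < ?c"
    using b by simp
  show "3.0776 * ?c < ?s"
  proof (rule power2_less_imp_less)
    show "(3.0776 * ?c)\<^sup>2 < ?s\<^sup>2"
      unfolding sq power_mult_distrib using c2 b
      by (simp add: power2_eq_square)
  qed (use s in simp)
  show "?s < 3.0777 * ?c"
  proof (rule power2_less_imp_less)
    show "?s\<^sup>2 < (3.0777 * ?c)\<^sup>2"
      unfolding sq power_mult_distrib using c2 b
      by (simp add: power2_eq_square)
  qed (use b in simp)
qed

section \<open>Cones and an integer test for membership\<close>

text \<open>The two imaginary parts are the cross products of \<open>v\<close> with the rays at
  angles \<alpha> and \<beta>, so their signs say on which side of each ray \<open>v\<close>
  lies.\<close>

lemma polar_form_between:
  assumes "Im (v * cis (- \<alpha>)) > 0" "Im (v * cis (- \<beta>)) < 0"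
    and "\<alpha> < \<beta>" "\<beta> < \<alpha> + pi"
  obtains r t where "r > 0" "\<alpha> < t" "t < \<beta>" "v = of_real r * cis t"
proof -
  define w where "w = v * cis (- \<alpha>)"
  define s where "s = Arg w"
  have w: "Im w > 0"
    using assms(1) by (simp add: w_def)
  then have nz: "w \<noteq> 0"
    by auto
  have w_eq: "w = of_real (cmod w) * cis s"
    using nz by (simp add: s_def cis_Arg sgn_eq)
  have "sin s = Im w / cmod w"
    using nz by (simp add: s_def sin_Arg)
  then have "sin s > 0"
    using w nz by simp
  moreover have "- pi < s" "s \<le> pi"
    using Arg_bounded[of w] by (auto simp: s_def)
  ultimately have s: "0 < s" "s < pi"
    using sin_gt_zero[of "- s"] by (cases "s < 0"; force simp: less_le)+
  have v: "v = of_real (cmod w) * cis (\<alpha> + s)"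
  proof -
    have "v = w * cis \<alpha>"
      by (simp add: w_def mult.assoc cis_mult)
    also have "\<dots> = of_real (cmod w) * (cis s * cis \<alpha>)"
      by (subst w_eq) (simp add: mult.assoc)
    finally show ?thesis
      by (simp add: cis_mult add.commute)
  qed
  have "v * cis (- \<beta>) = of_real (cmod w) * cis (\<alpha> + s - \<beta>)"
    by (subst v) (simp add: mult.assoc cis_mult)
  then have "cmod w * sin (\<alpha> + s - \<beta>) < 0"
    using assms(2) by simp
  then have "sin (\<alpha> + s - \<beta>) < 0"
    using nz by (simp add: mult_less_0_iff)
  \<comment> \<open>Otherwise \<open>\<alpha> + s - \<beta>\<close> would lie between 0 and pi,
    where the sine is nonnegative.\<close>
  then have "\<alpha> + s < \<beta>"
    using sin_ge_zero[of "\<alpha> + s - \<beta>"] s assms(3) by force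
  then show thesis
    using that[of "cmod w" "\<alpha> + s"] nz s v by simp
qed

text \<open>Two arguments of \<open>v\<close> in [0, 2 pi], one of them strictly inside, differ by
  less than 2 pi and hence agree. So \<open>t\<close> also lies in the closed interval of cone
  \<open>j\<close>, which meets the open interval of cone \<open>k\<close> only if
  \<open>j = k\<close>.\<close>

lemma open_cone_membership:
  assumes "v = of_real r * cis t" "r > 0" "k < 5"
    and t: "2 * pi * real k / 5 < t" "t < 2 * pi * real (k + 1) / 5"
    and j: "j < 5"
  shows "p + v \<in> cone own p j \<longleftrightarrow> j = k"
proof
  assume "p + v \<in> cone own p j"
  then obtain r' t' where v': "v = of_real r' * cis t'" "r' > 0"
    and t': "2 * pi * real j / 5 \<le> t'" "t' \<le> 2 * pi * real (j + 1) / 5"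
    by (auto simp: cone_def)
  have r: "cmod v = r" "cmod v = r'"
    by (use assms(1,2) in \<open>simp add: norm_mult\<close>, use v' in \<open>simp add: norm_mult\<close>)
  have "is_Arg v t"
    unfolding is_Arg_def cis_conv_exp[symmetric] r(1) by (rule assms(1))
  moreover have "is_Arg v t'"
    unfolding is_Arg_def cis_conv_exp[symmetric] r(2) by (rule v'(1))
  moreover have "\<bar>t - t'\<bar> < 2 * pi"
  proof -
    have "2 * pi * real (k + 1) / 5 \<le> 2 * pi" "2 * pi * real (j + 1) / 5 \<le> 2 * pi"
      using \<open>k < 5\<close> j by (auto simp: field_simps)
    moreover have "0 \<le> 2 * pi * real k / 5" "0 \<le> 2 * pi * real j / 5"
      by auto
    ultimately show ?thesis
      using t t' by linarith
  qed
  ultimately have "t = t'"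
    using is_Arg_eqI r \<open>r > 0\<close> by force
  then have "2 * pi * real j / 5 < 2 * pi * real (k + 1) / 5"
    "2 * pi * real k / 5 < 2 * pi * real (j + 1) / 5"
    using t t' by linarith+
  then have "real j < real (k + 1)" "real k < real (j + 1)"
    using pi_gt_zero by (simp_all add: divide_less_cancel)
  then show "j = k"
    by linarith
next
  assume "j = k"
  then show "p + v \<in> cone own p j"
    using assms unfolding cone_def by force
qed

text \<open>
  Apart from the horizontal ray, the boundary rays of the cones have the slopes \<open>\<plusminus>tan (2\<pi>/5)\<close>
  and \<open>\<plusminus>tan (\<pi>/5)\<close>, which are enclosed by \<open>3.0776 < tan (2\<pi>/5) < 3.0777\<close> and
  \<open>0.7265 < tan (\<pi>/5) < 0.7266\<close>. The value \<open>5\<close> means that these bounds do not place the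
  vector in the interior of a cone.
\<close>

definition sector :: "int \<Rightarrow> int \<Rightarrow> nat" where
  "sector x y =
    (if 0 < y \<and> 10000 * y < 30776 * x then 0
     else if 0 < y \<and> 30777 * x < 10000 * y \<and> - 7266 * x < 10000 * y then 1
     else if 10000 * \<bar>y\<bar> < - 7265 * x then 2
     else if y < 0 \<and> 10000 * y < - 30777 * x \<and> 10000 * y < 7266 * x then 3
     else if y < 0 \<and> - 30776 * x < 10000 * y then 4
     else 5)"

lemma cos_sin_fifths:
  "cos (2 * pi * real 0 / 5) = 1" "sin (2 * pi * real 0 / 5) = 0"
  "cos (2 * pi * real 1 / 5) = cos (2 * pi / 5)" "sin (2 * pi * real 1 / 5) = sin (2 * pi / 5)"
  "cos (2 * pi * real 2 / 5) = - cos (pi / 5)" "sin (2 * pi * real 2 / 5) = sin (pi / 5)"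
  "cos (2 * pi * real 3 / 5) = - cos (pi / 5)" "sin (2 * pi * real 3 / 5) = - sin (pi / 5)"
  "cos (2 * pi * real 4 / 5) = cos (2 * pi / 5)" "sin (2 * pi * real 4 / 5) = - sin (2 * pi / 5)"
  "cos (2 * pi * real 5 / 5) = 1" "sin (2 * pi * real 5 / 5) = 0"
proof -
  have e2: "2 * pi * real 2 / 5 = pi - pi / 5" and e3: "2 * pi * real 3 / 5 = pi / 5 + pi"
    and e4: "2 * pi * real 4 / 5 = 2 * pi - 2 * pi / 5"
    by (auto simp: field_simps)
  show "cos (2 * pi * real 2 / 5) = - cos (pi / 5)" "sin (2 * pi * real 2 / 5) = sin (pi / 5)"
    unfolding e2 by (simp_all only: cos_pi_minus sin_pi_minus)
  show "cos (2 * pi * real 3 / 5) = - cos (pi / 5)" "sin (2 * pi * real 3 / 5) = - sin (pi / 5)"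
    unfolding e3 by (simp_all only: cos_periodic_pi sin_periodic_pi)
  show "cos (2 * pi * real 4 / 5) = cos (2 * pi / 5)"
    "sin (2 * pi * real 4 / 5) = - sin (2 * pi / 5)"
    unfolding e4 by (simp_all only: cos_2pi_minus sin_2pi_minus)
qed auto

text \<open>The slope \<open>s / c\<close> is known only to lie between \<open>l\<close> and
  \<open>u\<close>. The lower bound is decisive for \<open>x\<close> nonnegative, the upper one for
  \<open>x\<close> negative.\<close>

lemma slope_less_imp_cross_less:
  fixes x y l u :: real
  assumes "l * c < s" "s < u * c" "0 < c" "y < l * x" "y < u * x"
  shows "y * c < x * s"
proof (cases "0 \<le> x")
  case True
  have "y * c < l * x * c"
    using assms by simp
  also have "\<dots> \<le> x * s"
    using mult_left_mono[of "l * c" s x] True assms by (simp add: mult_ac)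
  finally show ?thesis .
next
  case False
  have "y * c < u * x * c"
    using assms by simp
  also have "\<dots> \<le> x * s"
    using mult_left_mono_neg[of s "u * c" x] False assms by (simp add: mult_ac)
  finally show ?thesis .
qed

lemma sector_polar_form:
  assumes k: "sector x y = k" "k < 5"
  obtains r t where "r > 0" "2 * pi * real k / 5 < t" "t < 2 * pi * real (k + 1) / 5"
    "Complex (of_int x) (of_int y) = of_real r * cis t"
proof -
  let ?x = "of_int x :: real" and ?y = "of_int y :: real"
  define C where "C = cos (pi / 5)"
  define S where "S = sin (pi / 5)"
  define c where "c = cos (2 * pi / 5)"
  define s where "s = sin (2 * pi / 5)"
  let ?cross = "\<lambda>k. ?y * cos (2 * pi * real k / 5) - ?x * sin (2 * pi * real k / 5)"
  have "0 < C"
    using cos_pi_fifth_bounds by (simp add: C_def)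
  note tan36 = slope_less_imp_cross_less[OF sin_pi_fifth_bounds, folded C_def S_def, OF this]
  note tan72 = slope_less_imp_cross_less[OF sin_two_pi_fifths_bounds, folded c_def s_def]
  note vals = cos_sin_fifths[folded C_def S_def c_def s_def]
  have "?cross k > 0 \<and> ?cross (k + 1) < 0"
  proof -
    consider
      "k = 0" "0 < y" "10000 * y < 30776 * x"
      | "k = 1" "0 < y" "30777 * x < 10000 * y" "- 7266 * x < 10000 * y"
      | "k = 2" "10000 * \<bar>y\<bar> < - 7265 * x"
      | "k = 3" "y < 0" "10000 * y < - 30777 * x" "10000 * y < 7266 * x"
      | "k = 4" "y < 0" "- 30776 * x < 10000 * y"
      using k unfolding sector_def by (auto split: if_splits)
    then show ?thesis
    \<comment> \<open>Changing the signs of the coordinates reduces every side of every slanted ray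
      to the one situation covered by \<open>tan36\<close> and \<open>tan72\<close>. Of the two
      slope conditions required there, the one not tested by \<open>sector\<close> follows from the
      sign of a coordinate.\<close>
    proof cases
      case 1
      then have "0 < ?y" "10000 * ?y < 30776 * ?x"
        by linarith+
      then show ?thesis
        using tan72[of ?y ?x] \<open>k = 0\<close> vals by simp
    next
      case 2
      then have "0 < ?y" "30777 * ?x < 10000 * ?y" "- 7266 * ?x < 10000 * ?y"
        by linarith+
      then show ?thesis
        using tan72[of "- ?y" "- ?x"] tan36[of "- ?y" ?x] \<open>k = 1\<close> vals by simp
    next
      case 3
      then have "10000 * ?y < - 7265 * ?x" "- 10000 * ?y < - 7265 * ?x"
        by linarith+
      then show ?thesis
        using tan36[of "?y" "- ?x"] tan36[of "- ?y" "- ?x"] \<open>k = 2\<close> vals by simp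
    next
      case 4
      then have "?y < 0" "10000 * ?y < - 30777 * ?x" "10000 * ?y < 7266 * ?x"
        by linarith+
      then show ?thesis
        using tan72[of "?y" "- ?x"] tan36[of "?y" ?x] \<open>k = 3\<close> vals by simp
    next
      case 5
      then have "?y < 0" "- 30776 * ?x < 10000 * ?y"
        by linarith+
      then show ?thesis
        using tan72[of "- ?y" ?x] \<open>k = 4\<close> vals by simp
    qed
  qed
  then have "Im (Complex ?x ?y * cis (- (2 * pi * real k / 5))) > 0"
    "Im (Complex ?x ?y * cis (- (2 * pi * real (k + 1) / 5))) < 0"
    by (simp_all only: times_complex.sel complex.sel cis.sel cos_minus sin_minus) argo+
  moreover have "2 * pi * real (k + 1) / 5 = 2 * pi * real k / 5 + 2 * pi / 5"
    by (simp only: of_nat_add of_nat_1 distrib_left add_divide_distrib mult_1_right)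
  then have "2 * pi * real k / 5 < 2 * pi * real (k + 1) / 5"
    "2 * pi * real (k + 1) / 5 < 2 * pi * real k / 5 + pi"
    using pi_gt_zero by linarith+
  ultimately show thesis
    by (rule polar_form_between) (rule that)
qed

lemma sector_cone_iff:
  assumes "sector x y = k" "k < 5" "j < 5"
  shows "p + Complex (of_int x) (of_int y) \<in> cone own p j \<longleftrightarrow> j = k"
proof -
  obtain r t where "r > 0" "2 * pi * real k / 5 < t" "t < 2 * pi * real (k + 1) / 5"
    "Complex (of_int x) (of_int y) = of_real r * cis t"
    using sector_polar_form[OF assms(1,2)] .
  then show ?thesis
    using open_cone_membership[of _ r t k j] assms by auto
qed

section \<open>Distance orders, arcs and graph distance\<close>

text \<open>The diameter of a pair is its distance, so pairs are compared by diameter first, and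
  ties are broken by a well-order of all sets of points.\<close>

lemma distance_order_exists: "\<exists>R. distance_order S R"
proof -
  obtain W :: "complex set rel" where "well_order_on UNIV W"
    using well_order_on by blast
  then have W: "trans W" "antisym W" "total_on UNIV W"
    by (auto simp: order_on_defs)
  let ?R = "inv_image ({(x, y). x < y} <*lex*> (W - Id)) (\<lambda>A. (diameter A, A))"
  have "trans {(x::real, y). x < y}"
    by (auto intro: transI)
  then have "trans ?R"
    by (intro trans_inv_image trans_lex_prod trans_diff_Id[OF W(1,2)])
  moreover have "irrefl ?R"
    by (auto simp: irrefl_def)
  moreover have "total_on (point_pairs S) ?R"
    using W(3) by (auto simp: total_on_def)
  moreover have "diameter {a, b} = dist a b" for a b :: complex
  proof (rule antisym)
    show "diameter {a, b} \<le> dist a b"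
      by (rule diameter_le) (auto simp: dist_norm norm_minus_commute)
  qed (auto intro: diameter_bounded_bound)
  ultimately have "distance_order S ?R"
    by (auto simp: distance_order_def strict_linear_order_on_def)
  then show ?thesis ..
qed

lemma no_arc_if_closer_in_cone:
  assumes R: "distance_order S R" and S: "p \<in> S" "q \<in> S" "q' \<in> S" "q \<noteq> p" "q' \<noteq> p"
    and cone: "\<And>i. i < 5 \<Longrightarrow> q \<in> cone own p i \<Longrightarrow> q' \<in> cone own p i"
    and closer: "dist p q' < dist p q"
  shows "(p, q) \<notin> parcs (directed_Y5 own S R)"
proof
  assume "(p, q) \<in> parcs (directed_Y5 own S R)"
  then obtain i where i: "i < 5" "q \<in> cone own p i"
    "\<And>r. r \<in> S \<inter> cone own p i \<Longrightarrow> r \<noteq> q \<Longrightarrow> ({p, q}, {p, r}) \<in> R"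
    by (auto simp: directed_Y5_def)
  have "({p, q}, {p, q'}) \<in> R"
    using i(3)[of q'] cone[OF i(1,2)] S(3) closer by blast
  moreover have "({p, q'}, {p, q}) \<in> R"
    using R S closer unfolding distance_order_def by metis
  ultimately show False
    using R unfolding distance_order_def strict_linear_order_on_def irrefl_def
    by (metis transD)
qed

lemma pverts_Y5: "pverts (Y5 own S R) = S"
  by (simp add: Y5_def directed_Y5_def)

lemma wf_digraph_Y5: "wf_digraph (with_proj (Y5 own S R))"
proof -
  have "wf_digraph (with_proj (directed_Y5 own S R))"
    by unfold_locales (auto simp: directed_Y5_def)
  then interpret pair_wf_digraph "Y5 own S R"
    unfolding Y5_def by (rule wf_digraph.wellformed_mk_symmetric)
  show ?thesis ..
qed

text \<open>The differences of \<open>f\<close> telescope along a walk. The absolute value covers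
  both orientations of an arc; if there is no walk, the infimum is infinite.\<close>

lemma potential_diff_le_graph_dist:
  assumes edge: "\<And>p q. (p, q) \<in> parcs (directed_Y5 own S R) \<Longrightarrow> \<bar>f p - f q\<bar> \<le> dist p q"
  shows "ereal (f b - f a) \<le> graph_dist (Y5 own S R) a b"
proof -
  interpret wf_digraph "with_proj (Y5 own S R)"
    by (rule wf_digraph_Y5)
  have "f b - f a \<le> awalk_cost (\<lambda>(u, v). dist u v) es" if "awalk a es b" for es
    using that
  proof (induction es arbitrary: a)
    case (Cons e es)
    obtain u v where e: "e = (u, v)"
      by fastforce
    from Cons.prems e have "(u, v) \<in> parcs (Y5 own S R)" "a = u" "awalk v es b"
      by (auto simp: awalk_Cons_iff)
    moreover from this have "f v - f u \<le> dist u v"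
      using edge[of u v] edge[of v u]
      by (auto simp: Y5_def parcs_mk_symmetric dist_commute abs_le_iff)
    ultimately show ?case
      using Cons.IH[of v] e by simp
  qed (simp add: awalk_Nil_iff)
  then show ?thesis
    unfolding graph_dist_def \<mu>_def by (auto intro!: INF_greatest)
qed

lemma stretch_factor_ge:
  assumes "a \<in> pverts G" "b \<in> pverts G" "a \<noteq> b"
    and d: "ereal (c * dist a b) \<le> graph_dist G a b"
  shows "ereal c \<le> stretch_factor G"
  unfolding stretch_factor_def
proof (rule Inf_greatest, clarify)
  fix \<rho> :: ereal
  assume "\<forall>a\<in>pverts G. \<forall>b\<in>pverts G. graph_dist G a b \<le> \<rho> * ereal (dist a b)"
  then have "ereal (c * dist a b) \<le> \<rho> * ereal (dist a b)"
    using assms order_trans by blast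
  then show "ereal c \<le> \<rho>"
    using \<open>a \<noteq> b\<close> by (cases \<rho>) auto
qed

section \<open>The point set and its potential\<close>

text \<open>
  The coordinates were found by a numerical search. The third entry of each triple is the value of
  a potential that changes along every edge of the Yao graph by at most the length of the edge.
  The two points with a large detour are the first two in the list.
\<close>

definition points :: "(int \<times> int \<times> int) list" where
  "points =
     [(0, 0, 0), (-5885, 1969, 17880), (-8237, -4706, 9515), (-9635, 3280, 14200), (-3337, -3689, 11675),
      (-10259, -603, 12027), (-2926, -4954, 10346), (-9358, -1258, 13140), (2832, -6, 2832), (-6422, -3390, 7274),
      (-5318, -5054, 9270), (-2264, -6902, 8302), (436, -4955, 4974), (-5557, -2761, 6205), (1637, -3687, 6702),
      (-8149, 3838, 14945), (-9386, 35, 10946), (-4661, -4994, 8611)]"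

fun steep :: "int \<times> int \<times> int \<Rightarrow> int \<times> int \<times> int \<Rightarrow> bool" where
  "steep (x, y, f) (x', y', f') \<longleftrightarrow> (x' - x)\<^sup>2 + (y' - y)\<^sup>2 < (f' - f)\<^sup>2"

text \<open>The third point certifies that the first does not choose the second. Requiring a value
  below 5 keeps two undecided vectors from counting as lying in the same cone.\<close>

fun blocks :: "int \<times> int \<times> int \<Rightarrow> int \<times> int \<times> int \<Rightarrow> int \<times> int \<times> int \<Rightarrow> bool" where
  "blocks (x, y, f) (x', y', f') (x'', y'', f'') \<longleftrightarrow>
     sector (x' - x) (y' - y) < 5 \<and>
     sector (x'' - x) (y'' - y) = sector (x' - x) (y' - y) \<and>
     (x'' - x)\<^sup>2 + (y'' - y)\<^sup>2 < (x' - x)\<^sup>2 + (y' - y)\<^sup>2"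

text \<open>The pairs are ordered and \<open>steep\<close> is symmetric, so neither orientation of a
  steep pair is an arc.\<close>

lemma steep_pairs_blocked:
  "\<forall>p \<in> set points. \<forall>q \<in> set points. steep p q \<longrightarrow> (\<exists>q' \<in> set points. blocks p q q')"
  by code_simp

fun location :: "int \<times> int \<times> int \<Rightarrow> complex" where
  "location (x, y, f) = Complex (of_int x) (of_int y)"

fun potential :: "int \<times> int \<times> int \<Rightarrow> real" where
  "potential (x, y, f) = of_int f"

lemma inj_on_location: "inj_on location (set points)"
proof -
  have "distinct (map (\<lambda>(x, y, f). (x, y)) points)"
    unfolding points_def by simp
  then have "inj_on (\<lambda>(x, y, f). (x, y)) (set points)"
    by (simp add: distinct_map)
  \<comment> \<open>Floors of the real and imaginary parts recover the integer coordinates from a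
    location.\<close>
  then show ?thesis
    by (rule inj_on_imageI2[of "\<lambda>z. (\<lfloor>Re z\<rfloor>, \<lfloor>Im z\<rfloor>)", OF inj_on_cong[THEN iffD1, rotated]])
      auto
qed

lemma dist_location:
  "dist (location (x, y, f)) (location (x', y', f')) =
    sqrt (of_int ((x' - x)\<^sup>2 + (y' - y)\<^sup>2))"
  by (simp add: dist_norm cmod_def power2_commute[of "of_int x'"] power2_commute[of "of_int y'"])

lemma not_steep_imp_diff_le_dist:
  assumes "\<not> steep p q"
  shows "\<bar>potential p - potential q\<bar> \<le> dist (location p) (location q)"
proof -
  obtain x y f x' y' f' where pq: "p = (x, y, f)" "q = (x', y', f')"
    by (metis prod_cases3)
  have "real_of_int ((f' - f)\<^sup>2) \<le> of_int ((x' - x)\<^sup>2 + (y' - y)\<^sup>2)"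
    using assms unfolding pq by (simp only: steep.simps not_less of_int_le_iff)
  then have "sqrt ((of_int f - of_int f')\<^sup>2) \<le> sqrt (of_int ((x' - x)\<^sup>2 + (y' - y)\<^sup>2))"
    by (intro real_sqrt_le_mono) (simp add: power2_commute[of "of_int f"])
  then show ?thesis
    unfolding pq dist_location by simp
qed

text \<open>Ensures that a blocking point differs from the apex, as
  \<open>no_arc_if_closer_in_cone\<close> demands.\<close>

lemma not_blocks_self: "\<not> blocks p q p"
proof -
  have "sector 0 0 = 5"
    by (simp add: sector_def)
  then show ?thesis
    by (cases p; cases q) simp
qed

lemma blocks_imp_closer_in_cone:
  assumes "blocks p q q'"
  shows "dist (location p) (location q') < dist (location p) (location q)"
    and "i < 5 \<Longrightarrow> location q \<in> cone own (location p) i \<longleftrightarrow>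
      location q' \<in> cone own (location p) i"
proof -
  obtain x y f x' y' f' x'' y'' f''
    where pqr: "p = (x, y, f)" "q = (x', y', f')" "q' = (x'', y'', f'')"
    by (metis prod_cases3)
  have 1: "sector (x' - x) (y' - y) < 5"
    and 2: "sector (x'' - x) (y'' - y) = sector (x' - x) (y' - y)"
    and closer: "(x'' - x)\<^sup>2 + (y'' - y)\<^sup>2 < (x' - x)\<^sup>2 + (y' - y)\<^sup>2"
    using assms unfolding pqr by simp_all
  show "dist (location p) (location q') < dist (location p) (location q)"
    unfolding pqr dist_location using closer by (simp only: real_sqrt_less_iff of_int_less_iff)
  have shift: "location (x, y, f) + Complex (of_int (u - x)) (of_int (v - y)) = location (u, v, g)"
    for u v g
    by (simp add: complex_eq_iff)
  show "location q \<in> cone own (location p) i \<longleftrightarrow> location q' \<in> cone own (location p) i"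
    if "i < 5"
    using sector_cone_iff[OF refl 1 that, of "location p" own]
      sector_cone_iff[OF 2 1 that, of "location p" own]
    unfolding pqr shift[of x' y' f'] shift[of x'' y'' f''] by simp
qed

lemma potential_le_graph_dist_points:
  assumes R: "distance_order (location ` set points) R"
    and "a \<in> set points" "b \<in> set points"
  shows "ereal (potential b - potential a)
    \<le> graph_dist (Y5 own (location ` set points) R) (location a) (location b)"
proof -
  let ?S = "location ` set points"
  \<comment> \<open>Arcs join complex numbers, so the potential is carried over to them by inverting
    \<open>location\<close>.\<close>
  define h where "h = potential \<circ> inv_into (set points) location"
  have h: "h (location p) = potential p" if "p \<in> set points" for p
    using that inj_on_location by (simp add: h_def)
  have "\<bar>h u - h v\<bar> \<le> dist u v" if arc: "(u, v) \<in> parcs (directed_Y5 own ?S R)" for u v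
  proof -
    have "u \<in> ?S" "v \<in> ?S"
      using arc by (auto simp: directed_Y5_def)
    then obtain p q where pq: "p \<in> set points" "q \<in> set points" "u = location p" "v = location q"
      by blast
    have "\<not> steep p q"
    proof
      assume "steep p q"
      then obtain q' where q': "q' \<in> set points" "blocks p q q'"
        using steep_pairs_blocked pq by blast
      have "q' \<noteq> p"
        using q'(2) not_blocks_self by blast
      then have "location q' \<noteq> location p"
        using inj_on_location q' pq by (simp add: inj_on_eq_iff)
      moreover have "location q \<noteq> location p"
        using blocks_imp_closer_in_cone(1)[OF q'(2)] zero_le_dist[of "location p" "location q'"]
        by (metis dist_self not_less)
      ultimately have "(location p, location q) \<notin> parcs (directed_Y5 own ?S R)"
        using pq q'(1)
        by (intro no_arc_if_closer_in_cone[OF R _ _ imageI[OF q'(1)]])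
          (simp_all add: blocks_imp_closer_in_cone[OF q'(2)])
      then show False
        using arc pq by simp
    qed
    then show ?thesis
      using not_steep_imp_diff_le_dist[of p q] pq h by simp
  qed
  from potential_diff_le_graph_dist[OF this, where a = "location a" and b = "location b"]
  show ?thesis
    using h assms by simp
qed

section \<open>The large detour and the lower bound\<close>

text \<open>The points are fixed before \<open>R\<close>, so the detour persists under every way of
  breaking ties.\<close>

lemma Y5_long_detour:
  "\<exists>S a b. finite S \<and> a \<in> S \<and> b \<in> S \<and> a \<noteq> b \<and>
    (\<forall>R. distance_order S R \<longrightarrow> ereal (2.88 * dist a b) \<le> graph_dist (Y5 own S R) a b)"
proof -
  let ?S = "location ` set points"
  let ?a = "(0, 0, 0)" and ?b = "(-5885, 1969, 17880)"
  have ab: "?a \<in> set points" "?b \<in> set points"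
    by (simp_all add: points_def)
  have "2.88 * dist (location ?a) (location ?b) \<le> potential ?b - potential ?a"
  \<comment> \<open>Squaring removes the root: 17880 squared is about 8.30 times the squared
    distance 38510186, and 2.88 squared is about 8.29.\<close>
  proof (rule power2_le_imp_le)
    show "(2.88 * dist (location ?a) (location ?b))\<^sup>2 \<le> (potential ?b - potential ?a)\<^sup>2"
      unfolding dist_location power_mult_distrib by (simp add: power_divide)
  qed simp
  then have "ereal (2.88 * dist (location ?a) (location ?b))
      \<le> graph_dist (Y5 own ?S R) (location ?a) (location ?b)" if "distance_order ?S R" for R
    using order_trans[OF _ potential_le_graph_dist_points[OF that ab]] ereal_less_eq(3) by blast
  moreover have "location ?a \<noteq> location ?b"
    by simp
  ultimately show ?thesis
    using ab by (intro exI[of _ ?S] exI[of _ "location ?a"] exI[of _ "location ?b"]) blast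
qed

theorem mainTheorem2:
  fixes own :: "nat \<Rightarrow> bool"
  shows "(\<exists>S R. finite S \<and> distance_order S R \<and>
            stretch_factor (Y5 own S R) > ereal 2.87 \<and>
            (\<exists>a\<in>S. \<exists>b\<in>S. a \<noteq> b \<and>
               graph_dist (Y5 own S R) a b > ereal (2.87 * dist a b))) \<and>
         (\<forall>\<rho>::ereal. (\<forall>S R. finite S \<and> distance_order S R \<longrightarrow>
              stretch_factor (Y5 own S R) \<le> \<rho>) \<longrightarrow> ereal 2.87 \<le> \<rho>)"
proof -
  obtain S a b where S: "finite S" "a \<in> S" "b \<in> S" "a \<noteq> b"
    and detour: "\<And>R. distance_order S R \<Longrightarrow>
      ereal (2.88 * dist a b) \<le> graph_dist (Y5 own S R) a b"
    using Y5_long_detour[of own] by blast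
  obtain R where R: "distance_order S R"
    using distance_order_exists by blast
  have "ereal 2.88 \<le> stretch_factor (Y5 own S R)"
    using stretch_factor_ge[OF _ _ S(4) detour[OF R]] S by (simp add: pverts_Y5)
  \<comment> \<open>The margin between 2.88 and 2.87 turns the weak bound into a strict one.\<close>
  then have stretch: "ereal 2.87 < stretch_factor (Y5 own S R)"
    by (rule less_le_trans[rotated]) simp
  have "ereal (2.87 * dist a b) < graph_dist (Y5 own S R) a b"
    by (rule less_le_trans[OF _ detour[OF R]]) (use S in simp)
  then have "\<exists>S R. finite S \<and> distance_order S R \<and>
      stretch_factor (Y5 own S R) > ereal 2.87 \<and>
      (\<exists>a\<in>S. \<exists>b\<in>S. a \<noteq> b \<and> graph_dist (Y5 own S R) a b > ereal (2.87 * dist a b))"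
    using S R stretch by blast
  moreover have "ereal 2.87 \<le> \<rho>"
    if "\<forall>S R. finite S \<and> distance_order S R \<longrightarrow> stretch_factor (Y5 own S R) \<le> \<rho>" for \<rho>
  proof -
    have "stretch_factor (Y5 own S R) \<le> \<rho>"
      using that S(1) R by blast
    with stretch show ?thesis
      by (rule less_imp_le[OF less_le_trans])
  qed
  ultimately show ?thesis
    by blast
qed

end
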